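(* Under $123 \leftrightarrow 13*$, there exists a distinct equivalence class for every triple of integers $(m,p,v)$, with $1\le p,v\le m$, consisting of all permutations $\pi$ with the following properties: (i) $\pi$ has $m$ left-to-right minima; (ii) the position (from the left) of the leftmost non-left-to-right minimum of $\pi$ is $p+1$; (iii) the value of the largest non-left-to-right minimum of $\pi$ is greater than those of (exactly) $v$ left-to-right minima. In addition, each reverse identity permutation is in a class only containing itself. There are no other classes.
   Context: A permutation of length $n\ge 0$ is a string consisting of the integers $1,\dots,n$, each occurring exactly once. The reverse identity permutation of length $n$ is $n(n-1)(n-2)\cdots 1$ (the empty permutation if $n=0$). An element of a permutation is a left-to-right minimum if its value is less than that of every element to its left (so the first element is one); a non-left-to-right minimum is an element that is not a left-to-right minimum. Substrings are not required to be contiguous. $*$-patterns. For strings $\rho,\delta$ of distinct positive integers and symbols $*$ (several $*$'s are allowed), a (not necessarily contiguous) substring $r$ of $\rho$ is a copy of $\delta$ if $r$ and $\delta$ have $*$'s in the same positions and, ignoring all $*$'s, are order-isomorphic. Replacement. Let $\alpha,\beta$ be $*$-patterns of equal length. A permutation $\sigma$ is a result of the replacement $\alpha\to\beta$ on a permutation $\pi$ if it can be obtained as follows. (1) Renumber the integers of $\pi$ as necessary by positive integers, preserving relative order, and insert any number of $*$'s anywhere; call the result $\rho^{(1)}$. (2) Choose a substring $a$ of $\rho^{(1)}$ that is a copy of $\alpha$, and a string $b$ of distinct positive integers and $*$'s such that: $b$ is a copy of $\beta$; all (integer) elements common to $b$ and $\rho^{(1)}$ are contained in $a$; and for every integer $x$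 occurring in both $\alpha$ and $\beta$, if $y$ is the integer in $a$ at the same position as $x$ in $\alpha$, then $y$ is in $b$ at the same position as $x$ in $\beta$. Replace $a$ by $b$ in $\rho^{(1)}$ (position by position). (3) Delete all $*$'s and renumber, preserving relative order, to get the permutation $\sigma$. Elements involved need not be adjacent in position or value, and the length may change. Equivalence. Two permutations (possibly of different lengths) are equivalent under $\alpha\leftrightarrow\beta$ if one can be obtained from the other by a finite (possibly empty) sequence of $\alpha\to\beta$ and $\beta\to\alpha$ replacements. This partitions the set of all permutations $S_0\cup S_1\cup S_2\cup\cdots$ into equivalence classes.
   Formalization: As stated the claim fails, e.g. for (m,p,v)=(2,1,1), where no permutation has properties (i)–(iii); the triples are restricted to those with also p+v>m, and it is proved that for p+v≤m no permutation has the properties. *)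

theory Defs
  imports Main
begin

text \<open>Permutations are lists in one-line notation; the entry in position \<open>i\<close> (counted from 1)
  is \<open>\<pi> ! (i - 1)\<close>.\<close>

definition is_perm :: "nat list \<Rightarrow> bool" where
  "is_perm \<pi> \<longleftrightarrow> distinct \<pi> \<and> set \<pi> = {1..length \<pi>}"

definition reverse_identity :: "nat \<Rightarrow> nat list" where
  "reverse_identity n = rev [1..<Suc n]"

definition lr_minima :: "nat list \<Rightarrow> nat set" where
  "lr_minima \<pi> = {i. i < length \<pi> \<and> (\<forall>j<i. \<pi> ! i < \<pi> ! j)}"

definition non_lr_minima :: "nat list \<Rightarrow> nat set" where
  "non_lr_minima \<pi> = {i. i < length \<pi>} - lr_minima \<pi>"

text \<open>Both sets above consist of 0-based indices, not of values.\<close>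


text \<open>A string of integers and stars; \<open>None\<close> is the symbol \<open>*\<close>.\<close>

type_synonym star_string = "nat option list"

definition ints :: "star_string \<Rightarrow> nat list" where
  "ints s = List.map_filter id s"

definition valid_string :: "star_string \<Rightarrow> bool" where
  "valid_string s \<longleftrightarrow> distinct (ints s) \<and> (\<forall>x \<in> set (ints s). 0 < x)"

definition order_iso :: "nat list \<Rightarrow> nat list \<Rightarrow> bool" where
  "order_iso u w \<longleftrightarrow> length u = length w \<and>
     (\<forall>i<length u. \<forall>j<length u. u ! i < u ! j \<longleftrightarrow> w ! i < w ! j)"

definition is_copy :: "star_string \<Rightarrow> star_string \<Rightarrow> bool" where
  "is_copy r \<delta> \<longleftrightarrow> length r = length \<delta> \<and>
     (\<forall>i<length r. r ! i = None \<longleftrightarrow> \<delta> ! i = None) \<and>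
     order_iso (ints r) (ints \<delta>)"

definition entries_at :: "'a list \<Rightarrow> nat list \<Rightarrow> 'a list" where
  "entries_at s is = map ((!) s) is"

text \<open>In \<open>replacement \<alpha> \<beta> \<pi> \<sigma>\<close>, the list \<open>is\<close> holds the increasing positions of the chosen
  substring \<open>a\<close> of \<open>\<rho>1\<close>, and \<open>\<rho>2\<close> is \<open>\<rho>1\<close> with \<open>a\<close> replaced by \<open>b\<close> at these positions.
  Renumbering preserving relative order, together with inserting or deleting stars, is expressed
  by order isomorphism between the integers of a string and a permutation.\<close>

definition replacement ::
    "star_string \<Rightarrow> star_string \<Rightarrow> nat list \<Rightarrow> nat list \<Rightarrow> bool" where
  "replacement \<alpha> \<beta> \<pi> \<sigma> \<longleftrightarrow> is_perm \<pi> \<and> is_perm \<sigma> \<and>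
     (\<exists>\<rho>1 \<rho>2 is a b.
        valid_string \<rho>1 \<and> order_iso (ints \<rho>1) \<pi> \<and>
        sorted_wrt (<) is \<and> (\<forall>i \<in> set is. i < length \<rho>1) \<and>
        a = entries_at \<rho>1 is \<and> is_copy a \<alpha> \<and>
        valid_string b \<and> is_copy b \<beta> \<and>
        set (ints b) \<inter> set (ints \<rho>1) \<subseteq> set (ints a) \<and>
        (\<forall>x. \<forall>i<length \<alpha>. \<forall>j<length \<beta>.
           \<alpha> ! i = Some x \<and> \<beta> ! j = Some x \<longrightarrow> b ! j = a ! i) \<and>
        length \<rho>2 = length \<rho>1 \<and> entries_at \<rho>2 is = b \<and>
        (\<forall>i<length \<rho>1. i \<notin> set is \<longrightarrow> \<rho>2 ! i = \<rho>1 ! i) \<and>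
        order_iso (ints \<rho>2) \<sigma>)"

definition step :: "star_string \<Rightarrow> star_string \<Rightarrow> nat list \<Rightarrow> nat list \<Rightarrow> bool" where
  "step \<alpha> \<beta> \<pi> \<sigma> \<longleftrightarrow> replacement \<alpha> \<beta> \<pi> \<sigma> \<or> replacement \<beta> \<alpha> \<pi> \<sigma>"

definition equivalence :: "star_string \<Rightarrow> star_string \<Rightarrow> (nat list \<times> nat list) set" where
  "equivalence \<alpha> \<beta> = {(\<pi>, \<sigma>). is_perm \<pi> \<and> is_perm \<sigma> \<and>
     ((step \<alpha> \<beta>)\<^sup>*\<^sup>* \<pi> \<sigma> \<or> (step \<alpha> \<beta>)\<^sup>*\<^sup>* \<sigma> \<pi>)}"

definition equiv_classes :: "star_string \<Rightarrow> star_string \<Rightarrow> nat list set set" where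
  "equiv_classes \<alpha> \<beta> = {\<pi>. is_perm \<pi>} // equivalence \<alpha> \<beta>"

definition pattern_123 :: star_string where
  "pattern_123 = [Some 1, Some 2, Some 3]"

definition pattern_13s :: star_string where
  "pattern_13s = [Some 1, Some 3, None]"


text \<open>The leftmost non-left-to-right minimum is in position \<open>p + 1\<close>, i.e. has index \<open>p\<close>.
  That one exists has to be required, since \<open>Min {}\<close> and \<open>Max {}\<close> are unspecified values.\<close>

definition class_set :: "nat \<Rightarrow> nat \<Rightarrow> nat \<Rightarrow> nat list set" where
  "class_set m p v = {\<pi>. is_perm \<pi> \<and> non_lr_minima \<pi> \<noteq> {} \<and>
     card (lr_minima \<pi>) = m \<and>
     Min (non_lr_minima \<pi>) = p \<and>
     card {i \<in> lr_minima \<pi>. \<pi> ! i < Max ((!) \<pi> ` non_lr_minima \<pi>)} = v}"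

end

theory Submission
  imports Defs
begin

text \<open>
  Write \<open>x y z \<rightarrow> x z\<close> for the replacement of 123 by 13*: in an increasing subsequence
  \<open>x y z\<close> the entry \<open>y\<close> is deleted and \<open>z\<close> moves into its place. Read backwards, an entry
  \<open>z\<close> preceded by some smaller \<open>x\<close> moves anywhere to the right, and a new entry between \<open>x\<close>
  and \<open>z\<close> takes its place. Replacements can be undone (\<open>replacement_converse\<close>), so the
  classes are those of the equivalence relation generated by this move.

  The three parameters are invariant (\<open>move_invariants\<close>). The entries \<open>y\<close> and \<open>z\<close> are not
  left-to-right minima, because \<open>x\<close> is smaller and stands before both, so the values of the
  minima do not change. The place of \<open>y\<close> is occupied by a non-minimum before and after the
  move and nothing to its left changes, which fixes the position of the first non-minimum. As
  \<open>y < z\<close>, deleting \<open>y\<close> does not change the largest non-minimum.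

  Conversely, the parameters determine the class. The key is that any permutation with two
  non-minima is equivalent to a shorter one. Let \<open>z\<close> and a later \<open>t\<close> be non-minima, with
  \<open>x < z\<close> before \<open>z\<close> and \<open>s < t\<close> before \<open>t\<close>. If \<open>z < t\<close>, the move
  \<open>x z t \<rightarrow> x t\<close> applies at once. If \<open>t < z\<close>, there may be no increasing triple at all, and
  the permutation first has to grow (\<open>delete_smaller_later\<close>): a new entry \<open>y\<close>, slightly larger
  than \<open>x\<close>, takes the place of \<open>z\<close>, while \<open>z\<close> moves to just behind \<open>t\<close>. Now
  \<open>s t z \<rightarrow> s z\<close> removes \<open>t\<close> and \<open>x y z \<rightarrow> x z\<close> brings \<open>z\<close> back to its old place; the
  net effect is the deletion of \<open>t\<close>. So every permutation with a non-minimum is equivalent to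
  one with exactly one non-minimum, and such a permutation is determined by the parameters
  (\<open>single_unique\<close>): there are \<open>m\<close> decreasing entries, and the entry \<open>v + 1\<close> in
  position \<open>p + 1\<close>.

  Permutations in which every entry is a left-to-right minimum are decreasing, and no move or
  inverse move applies to them. Finally, \<open>m < p + v\<close> is forced: the minima from position \<open>p\<close>
  on lie below the first non-minimum, which is preceded by the minimum in position \<open>p\<close> and
  exceeds it; there are \<open>m - p + 1\<close> of them.
\<close>

section \<open>Order isomorphism and standardization\<close>

lemma order_iso_sym: "order_iso u w \<Longrightarrow> order_iso w u"
  by (auto simp: order_iso_def)

text \<open>The renumbering of a string of distinct integers to a permutation: each entry becomes its
  rank. It allows moves to be described on arbitrary distinct lists, where deleting or inserting
  an entry leaves the others unchanged.\<close>

definition std :: "nat list \<Rightarrow> nat list" where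
  "std w = map (\<lambda>i. card {j. j < length w \<and> w ! j \<le> w ! i}) [0..<length w]"

lemma length_std [simp]: "length (std w) = length w"
  by (simp add: std_def)

lemma std_eq_if_order_iso:
  assumes "order_iso u w"
  shows "std u = std w"
proof -
  have "{j. j < length u \<and> u ! j \<le> u ! i} = {j. j < length w \<and> w ! j \<le> w ! i}"
    if "i < length w" for i
    using assms that by (auto simp: order_iso_def not_less [symmetric])
  then show ?thesis
    using assms by (auto simp: std_def order_iso_def)
qed

lemma order_iso_std: "order_iso (std w) w"
proof -
  let ?c = "\<lambda>i. card {j. j < length w \<and> w ! j \<le> w ! i}"
  have mono: "?c i \<le> ?c j" if "w ! i \<le> w ! j" for i j
    using that by (intro card_mono) auto
  have strict: "?c i < ?c j" if "j < length w" "w ! i < w ! j" for i j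
  proof (rule psubset_card_mono)
    have "{k. k < length w \<and> w ! k \<le> w ! i} \<subseteq> {k. k < length w \<and> w ! k \<le> w ! j}"
      using that by auto
    moreover have "j \<in> {k. k < length w \<and> w ! k \<le> w ! j}" "j \<notin> {k. k < length w \<and> w ! k \<le> w ! i}"
      using that by auto
    ultimately show "{k. k < length w \<and> w ! k \<le> w ! i} \<subset> {k. k < length w \<and> w ! k \<le> w ! j}"
      by blast
  qed simp
  have "?c i < ?c j \<longleftrightarrow> w ! i < w ! j" if "i < length w" "j < length w" for i j
    using mono [of j i] strict [of j i] that by (meson leD le_less_linear)
  then show ?thesis
    by (auto simp: order_iso_def std_def)
qed

lemma is_perm_std:
  assumes "distinct w"
  shows "is_perm (std w)"
proof -
  have d: "distinct (std w)"
  proof (simp add: distinct_conv_nth, intro allI impI)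
    fix i j assume ij: "i < length w" "j < length w" "i \<noteq> j"
    then have "w ! i \<noteq> w ! j"
      using assms by (simp add: nth_eq_iff_index_eq)
    then have "w ! i < w ! j \<or> w ! j < w ! i" by auto
    then have "std w ! i < std w ! j \<or> std w ! j < std w ! i"
      using order_iso_std [of w] ij by (auto simp: order_iso_def)
    then show "std w ! i \<noteq> std w ! j" by auto
  qed
  have "set (std w) \<subseteq> {1..length w}"
  proof
    fix t assume "t \<in> set (std w)"
    then obtain i where i: "i < length w" "t = card {j. j < length w \<and> w ! j \<le> w ! i}"
      by (auto simp: std_def)
    then have "i \<in> {j. j < length w \<and> w ! j \<le> w ! i}" by simp
    then have "0 < t"
      unfolding i(2) by (auto simp: card_gt_0_iff)
    moreover have "t \<le> card {..<length w}"
      unfolding i(2) by (intro card_mono) auto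
    ultimately show "t \<in> {1..length w}" by simp
  qed
  then have "set (std w) = {1..length w}"
    using distinct_card [OF d] by (intro card_subset_eq) auto
  with d show ?thesis by (simp add: is_perm_def)
qed

lemma std_perm:
  assumes "is_perm \<pi>"
  shows "std \<pi> = \<pi>"
proof (rule nth_equalityI)
  fix i assume "i < length (std \<pi>)"
  then have i: "i < length \<pi>" by simp
  have d: "distinct \<pi>" and s: "set \<pi> = {1..length \<pi>}"
    using assms by (auto simp: is_perm_def)
  have "(!) \<pi> ` {j. j < length \<pi> \<and> \<pi> ! j \<le> \<pi> ! i} = {t \<in> set \<pi>. t \<le> \<pi> ! i}"
    by (auto simp: set_conv_nth)
  also have "\<dots> = {1..\<pi> ! i}"
    using nth_mem [OF i] unfolding s by auto
  finally have "card ((!) \<pi> ` {j. j < length \<pi> \<and> \<pi> ! j \<le> \<pi> ! i}) = \<pi> ! i"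
    by simp
  moreover have "inj_on ((!) \<pi>) {j. j < length \<pi> \<and> \<pi> ! j \<le> \<pi> ! i}"
    using d by (auto simp: inj_on_def nth_eq_iff_index_eq)
  ultimately show "std \<pi> ! i = \<pi> ! i"
    using i by (simp add: std_def card_image)
qed simp

section \<open>Replacements are reversible\<close>

lemma ints_simps [simp]:
  "ints [] = []"
  "ints (None # s) = ints s"
  "ints (Some x # s) = x # ints s"
  "ints (s @ t) = ints s @ ints t"
  "ints (map Some w) = w"
  by (auto simp: ints_def List.map_filter_def o_def)

lemma set_ints: "set (ints s) = {x. Some x \<in> set s}"
  by (force simp: ints_def List.map_filter_def)

lemma distinct_ints_iff:
  "distinct (ints s) \<longleftrightarrow>
    (\<forall>i<length s. \<forall>j<length s. s ! i = s ! j \<and> s ! i \<noteq> None \<longrightarrow> i = j)"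
proof (induction s)
  case (Cons c s)
  show ?case
  proof (cases c)
    case None
    then show ?thesis using Cons
      by (auto simp: All_less_Suc2)
  next
    case (Some x)
    then show ?thesis using Cons
      by (auto simp: All_less_Suc2 set_ints in_set_conv_nth)
  qed
qed simp

lemma Some_nth_in_ints: "i < length s \<Longrightarrow> s ! i = Some x \<Longrightarrow> x \<in> set (ints s)"
  by (metis mem_Collect_eq nth_mem set_ints)

lemma replacementI:
  assumes "is_perm \<pi>" "is_perm \<sigma>" "valid_string \<rho>1" "order_iso (ints \<rho>1) \<pi>"
    "sorted_wrt (<) is" "\<forall>i \<in> set is. i < length \<rho>1"
    "a = entries_at \<rho>1 is" "is_copy a \<alpha>" "valid_string b" "is_copy b \<beta>"
    "set (ints b) \<inter> set (ints \<rho>1) \<subseteq> set (ints a)"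
    "\<forall>x. \<forall>i<length \<alpha>. \<forall>j<length \<beta>. \<alpha> ! i = Some x \<and> \<beta> ! j = Some x \<longrightarrow> b ! j = a ! i"
    "length \<rho>2 = length \<rho>1" "entries_at \<rho>2 is = b"
    "\<forall>i<length \<rho>1. i \<notin> set is \<longrightarrow> \<rho>2 ! i = \<rho>1 ! i" "order_iso (ints \<rho>2) \<sigma>"
  shows "replacement \<alpha> \<beta> \<pi> \<sigma>"
  unfolding replacement_def using assms by blast

text \<open>The same positions serve for both directions: exchange \<open>\<rho>1\<close> with \<open>\<rho>2\<close> and \<open>a\<close> with
  \<open>b\<close>. The content is that \<open>\<rho>2\<close> again has distinct entries and shares with \<open>a\<close> only entries
  of \<open>b\<close>; this holds because no integer is repeated in \<open>\<rho>1\<close> or in \<open>b\<close>, and \<open>b\<close> shares with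
  \<open>\<rho>1\<close> only integers of \<open>a\<close>.\<close>

lemma replacement_converse:
  assumes "replacement \<alpha> \<beta> \<pi> \<sigma>"
  shows "replacement \<beta> \<alpha> \<sigma> \<pi>"
proof -
  from assms obtain \<rho>1 \<rho>2 "is" a b where perm: "is_perm \<pi>" "is_perm \<sigma>"
    and v1: "valid_string \<rho>1" and o1: "order_iso (ints \<rho>1) \<pi>"
    and srt: "sorted_wrt (<) is" and ran: "\<forall>i \<in> set is. i < length \<rho>1"
    and a: "a = entries_at \<rho>1 is" and ca: "is_copy a \<alpha>"
    and vb: "valid_string b" and cb: "is_copy b \<beta>"
    and new: "set (ints b) \<inter> set (ints \<rho>1) \<subseteq> set (ints a)"
    and com: "\<forall>x. \<forall>i<length \<alpha>. \<forall>j<length \<beta>. \<alpha> ! i = Some x \<and> \<beta> ! j = Some x \<longrightarrow> b ! j = a ! i"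
    and len: "length \<rho>2 = length \<rho>1" and b: "entries_at \<rho>2 is = b"
    and rest: "\<forall>i<length \<rho>1. i \<notin> set is \<longrightarrow> \<rho>2 ! i = \<rho>1 ! i"
    and o2: "order_iso (ints \<rho>2) \<sigma>"
    unfolding replacement_def by blast
  have d1: "i = j" if "i < length \<rho>1" "j < length \<rho>1" "\<rho>1 ! i = \<rho>1 ! j" "\<rho>1 ! i = Some x" for i j x
    using v1 that unfolding valid_string_def distinct_ints_iff by (metis option.distinct(1))
  have in_a: "x \<in> set (ints a) \<longleftrightarrow> (\<exists>i \<in> set is. \<rho>1 ! i = Some x)" for x
    unfolding a set_ints entries_at_def by force
  have in_b: "x \<in> set (ints b) \<longleftrightarrow> (\<exists>i \<in> set is. \<rho>2 ! i = Some x)" for x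
    unfolding b [symmetric] set_ints entries_at_def by force
  \<comment> \<open>A value kept outside the chosen positions cannot reappear inside them: by \<open>new\<close> it would
    be a value of \<open>a\<close> and so occur twice in \<open>\<rho>1\<close>.\<close>
  have cross: False if "i \<in> set is" "j < length \<rho>1" "j \<notin> set is" "\<rho>2 ! i = Some x" "\<rho>1 ! j = Some x"
    for i j x
  proof -
    have "x \<in> set (ints b)" using that in_b by blast
    moreover have "x \<in> set (ints \<rho>1)" using that Some_nth_in_ints by blast
    ultimately obtain k where "k \<in> set is" "\<rho>1 ! k = Some x" using new in_a by blast
    then show False using d1 [of k j] that ran by auto
  qed
  have inner: "i = j" if ij: "i \<in> set is" "j \<in> set is" "\<rho>2 ! i = Some x" "\<rho>2 ! j = Some x" for i j x
  proof -
    obtain p q where pq: "p < length is" "i = is ! p" "q < length is" "j = is ! q"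
      using ij by (metis in_set_conv_nth)
    have "b ! p = Some x" "b ! q = Some x" "p < length b" "q < length b"
      using pq ij unfolding b [symmetric] entries_at_def by auto
    then have "p = q"
      using vb unfolding valid_string_def distinct_ints_iff by (metis option.distinct(1))
    then show ?thesis using pq by simp
  qed
  have d2: "distinct (ints \<rho>2)"
    unfolding distinct_ints_iff
  proof (intro allI impI)
    fix i j assume ij: "i < length \<rho>2" "j < length \<rho>2" "\<rho>2 ! i = \<rho>2 ! j \<and> \<rho>2 ! i \<noteq> None"
    then obtain x where x: "\<rho>2 ! i = Some x" "\<rho>2 ! j = Some x" by (metis not_None_eq)
    show "i = j"
      using ij x rest len inner [of i j x] cross [of i j x] cross [of j i x] d1 [of i j x]
      by (cases "i \<in> set is"; cases "j \<in> set is") auto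
  qed
  have pos2: "\<forall>x \<in> set (ints \<rho>2). 0 < x"
  proof
    fix x assume "x \<in> set (ints \<rho>2)"
    then obtain i where i: "i < length \<rho>2" "\<rho>2 ! i = Some x"
      by (auto simp: set_ints in_set_conv_nth)
    show "0 < x"
    proof (cases "i \<in> set is")
      case True
      then show ?thesis using i vb in_b by (auto simp: valid_string_def)
    next
      case False
      then show ?thesis using i rest len v1 Some_nth_in_ints [of i \<rho>1 x]
        by (auto simp: valid_string_def)
    qed
  qed
  have va: "valid_string a"
  proof -
    have "distinct (ints a)"
      unfolding distinct_ints_iff
    proof (intro allI impI)
      fix p q assume pq: "p < length a" "q < length a" "a ! p = a ! q \<and> a ! p \<noteq> None"
      have len_a: "length a = length is" by (simp add: a entries_at_def)
      have "a ! p = \<rho>1 ! (is ! p)" "a ! q = \<rho>1 ! (is ! q)"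
        using pq len_a by (simp_all add: a entries_at_def)
      with pq have "\<rho>1 ! (is ! p) = \<rho>1 ! (is ! q)" "\<rho>1 ! (is ! p) \<noteq> None"
        by metis+
      then have "is ! p = is ! q"
        using d1 [of "is ! p" "is ! q"] ran pq len_a by auto
      then show "p = q"
        using strict_sorted_iff [of "is"] srt pq len_a by (simp add: nth_eq_iff_index_eq)
    qed
    moreover have "x \<in> set (ints \<rho>1)" if "x \<in> set (ints a)" for x
      using that in_a ran Some_nth_in_ints by blast
    ultimately show ?thesis using v1 by (auto simp: valid_string_def)
  qed
  have new': "set (ints a) \<inter> set (ints \<rho>2) \<subseteq> set (ints b)"
  proof
    fix x assume x: "x \<in> set (ints a) \<inter> set (ints \<rho>2)"
    then obtain i where i: "i < length \<rho>2" "\<rho>2 ! i = Some x"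
      by (auto simp: set_ints in_set_conv_nth)
    have "i \<in> set is"
    proof (rule ccontr)
      assume ni: "i \<notin> set is"
      then have r: "\<rho>1 ! i = Some x" using i rest len by simp
      obtain k where "k \<in> set is" "\<rho>1 ! k = Some x" using x in_a by blast
      then show False using d1 [of i k] i ran r len ni by auto
    qed
    then show "x \<in> set (ints b)" using in_b i by blast
  qed
  show ?thesis
  proof (rule replacementI [of \<sigma> \<pi> \<rho>2 "is" b \<beta> a \<alpha> \<rho>1])
    show "valid_string \<rho>2" using d2 pos2 by (simp add: valid_string_def)
    show "\<forall>x. \<forall>i<length \<beta>. \<forall>j<length \<alpha>. \<beta> ! i = Some x \<and> \<alpha> ! j = Some x \<longrightarrow> a ! j = b ! i"
      using com by metis
  qed (use perm o1 o2 srt ran len b ca cb va new' a rest in auto)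
qed

lemma step_sym: "step \<alpha> \<beta> \<pi> \<sigma> \<Longrightarrow> step \<alpha> \<beta> \<sigma> \<pi>"
  unfolding step_def using replacement_converse by blast

lemma steps_sym: "(step \<alpha> \<beta>)\<^sup>*\<^sup>* \<pi> \<sigma> \<Longrightarrow> (step \<alpha> \<beta>)\<^sup>*\<^sup>* \<sigma> \<pi>"
  by (induction rule: rtranclp_induct) (auto intro: converse_rtranclp_into_rtranclp step_sym)

lemma equivalence_iff:
  "(\<pi>, \<sigma>) \<in> equivalence \<alpha> \<beta> \<longleftrightarrow> is_perm \<pi> \<and> is_perm \<sigma> \<and> (step \<alpha> \<beta>)\<^sup>*\<^sup>* \<pi> \<sigma>"
  unfolding equivalence_def using steps_sym by blast

section \<open>The replacement of 123 by 13* on lists\<close>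

text \<open>The star of the pattern is the position that \<open>z\<close> vacates, so \<open>\<rho>1\<close> can be taken without
  stars.\<close>

lemma replacement_std:
  assumes d: "distinct (L @ y # C @ z # D)" and pos: "0 \<notin> set (L @ y # C @ z # D)"
    and x: "x \<in> set L" "x < y" "y < z"
  shows "replacement pattern_123 pattern_13s (std (L @ y # C @ z # D)) (std (L @ z # C @ D))"
proof -
  obtain A B where L: "L = A @ x # B" using x(1) by (meson split_list)
  define j where "j = Suc (length A + length B)"
  define k where "k = Suc (j + length C)"
  define \<rho>1 where "\<rho>1 = map Some (L @ y # C @ z # D)"
  define \<rho>2 where "\<rho>2 = \<rho>1 [j := Some z, k := None]"
  have jL: "j = length L" by (simp add: j_def L)
  have \<rho>2: "\<rho>2 = map Some L @ Some z # map Some C @ None # map Some D"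
    by (simp add: \<rho>2_def \<rho>1_def jL k_def list_update_append)
  have nth: "\<rho>1 ! length A = Some x" "\<rho>1 ! j = Some y" "\<rho>1 ! k = Some z"
    by (auto simp: \<rho>1_def L j_def k_def nth_append)
  have lt: "length A < j" "j < k" "k < length \<rho>1"
    by (auto simp: \<rho>1_def L j_def k_def)
  have "ints \<rho>1 = L @ y # C @ z # D" unfolding \<rho>1_def by (rule ints_simps)
  moreover have "ints \<rho>2 = L @ z # C @ D" unfolding \<rho>2 by simp
  moreover have "valid_string \<rho>1"
    using d pos unfolding valid_string_def calculation(1) by (metis gr0I)
  moreover have "is_copy [Some x, Some y, Some z] pattern_123"
    using x by (auto simp: is_copy_def pattern_123_def order_iso_def less_Suc_eq nth_Cons')
  moreover have "is_copy [Some x, Some z, None] pattern_13s"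
    using x by (auto simp: is_copy_def pattern_13s_def order_iso_def less_Suc_eq nth_Cons')
  moreover have "valid_string [Some x, Some z, None]"
    using x pos by (auto simp: valid_string_def L intro: gr0I)
  moreover have "\<forall>t. \<forall>i<length pattern_123. \<forall>j<length pattern_13s.
      pattern_123 ! i = Some t \<and> pattern_13s ! j = Some t \<longrightarrow>
      [Some x, Some z, None] ! j = [Some x, Some y, Some z] ! i"
    by (auto simp: pattern_123_def pattern_13s_def less_Suc_eq)
  moreover have "distinct (L @ z # C @ D)" using d by auto
  ultimately show ?thesis
    using nth lt d
    by (intro replacementI [of _ _ \<rho>1 "[length A, j, k]" "[Some x, Some y, Some z]" _
          "[Some x, Some z, None]" _ \<rho>2])
      (auto simp: entries_at_def \<rho>2_def order_iso_sym [OF order_iso_std] is_perm_std)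
qed

text \<open>Conversely, every replacement has the form of \<open>replacement_std\<close> once stars are dropped.
  The integers 1 and 3 occur in both patterns, which forces \<open>b\<close> to be \<open>x z *\<close>; hence \<open>\<rho>2\<close>
  is determined by \<open>\<rho>1\<close> and the chosen positions.\<close>

lemma replacementE:
  assumes "replacement pattern_123 pattern_13s \<pi> \<sigma>"
  obtains L x y C z D where "distinct (L @ y # C @ z # D)" "x \<in> set L" "x < y" "y < z"
    "order_iso (L @ y # C @ z # D) \<pi>" "order_iso (L @ z # C @ D) \<sigma>"
proof -
  from assms obtain \<rho>1 \<rho>2 "is" a b where 
    v1: "valid_string \<rho>1" and o1: "order_iso (ints \<rho>1) \<pi>"
    and srt: "sorted_wrt (<) is" and ran: "\<forall>i \<in> set is. i < length \<rho>1"
    and a: "a = entries_at \<rho>1 is" and ca: "is_copy a pattern_123"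
    and cb: "is_copy b pattern_13s"
    and com: "\<forall>x. \<forall>i<length pattern_123. \<forall>j<length pattern_13s.
       pattern_123 ! i = Some x \<and> pattern_13s ! j = Some x \<longrightarrow> b ! j = a ! i"
    and len: "length \<rho>2 = length \<rho>1" and b: "entries_at \<rho>2 is = b"
    and rest: "\<forall>i<length \<rho>1. i \<notin> set is \<longrightarrow> \<rho>2 ! i = \<rho>1 ! i"
    and o2: "order_iso (ints \<rho>2) \<sigma>"
    unfolding replacement_def by blast
  have "length a = 3" using ca by (simp add: is_copy_def pattern_123_def)
  then have "length is = 3" by (simp add: a entries_at_def)
  then obtain i j k where is_eq: "is = [i, j, k]"
    by (auto simp: numeral_3_eq_3 length_Suc_conv)
  have lt: "i < j" "j < k" "k < length \<rho>1" using srt ran by (auto simp: is_eq)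
  have a3: "a = [\<rho>1 ! i, \<rho>1 ! j, \<rho>1 ! k]" and b3: "b = [\<rho>2 ! i, \<rho>2 ! j, \<rho>2 ! k]"
    using a b by (auto simp: is_eq entries_at_def)
  have "\<rho>1 ! i \<noteq> None" "\<rho>1 ! j \<noteq> None" "\<rho>1 ! k \<noteq> None"
    using ca by (auto simp: is_copy_def a3 pattern_123_def All_less_Suc2)
  then obtain x y z where xyz: "\<rho>1 ! i = Some x" "\<rho>1 ! j = Some y" "\<rho>1 ! k = Some z" by blast
  have "order_iso [x, y, z] [1, 2, 3]"
    using ca by (simp add: is_copy_def a3 pattern_123_def xyz)
  then have less: "x < y" "y < z"
    by (auto simp: order_iso_def All_less_Suc2)
  have "\<rho>2 ! i = Some x"
    using com [rule_format, of 0 0] by (simp add: b3 a3 xyz pattern_123_def pattern_13s_def)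
  moreover have "\<rho>2 ! j = Some z"
    using com [rule_format, of 2 1] by (simp add: b3 a3 xyz pattern_123_def pattern_13s_def)
  moreover have "\<rho>2 ! k = None"
    using cb by (auto simp: is_copy_def b3 pattern_13s_def All_less_Suc2)
  ultimately have \<rho>2: "\<rho>2 = \<rho>1 [j := Some z, k := None]"
    using len lt rest xyz by (intro nth_equalityI) (auto simp: nth_list_update is_eq)
  obtain P R S where PRS: "\<rho>1 = P @ Some y # R @ Some z # S" "length P = j"
    and kR: "k = Suc (j + length R)"
  proof
    define P R S where "P = take j \<rho>1" and "R = take (k - Suc j) (drop (Suc j) \<rho>1)"
      and "S = drop (Suc k) \<rho>1"
    have "drop (Suc j) \<rho>1 = R @ Some z # S"
      using id_take_nth_drop [of "k - Suc j" "drop (Suc j) \<rho>1"] lt xyz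
      by (simp add: R_def S_def)
    then show "\<rho>1 = take j \<rho>1 @ Some y # take (k - Suc j) (drop (Suc j) \<rho>1) @ Some z # drop (Suc k) \<rho>1"
      using id_take_nth_drop [of j \<rho>1] lt xyz by (simp add: R_def S_def)
  qed (use lt in auto)
  have "P ! i = Some x" using PRS lt xyz by (simp add: nth_append)
  then have xP: "x \<in> set (ints P)"
    using Some_nth_in_ints [of i P x] lt PRS by simp
  have "\<rho>2 = P @ Some z # R @ None # S"
    using PRS kR by (simp add: \<rho>2 list_update_append)
  then show thesis
    using that [of "ints P" y "ints R" z "ints S" x] xP less v1 o1 o2 PRS
    by (auto simp: valid_string_def)
qed

section \<open>Left-to-right minima and the three invariants\<close>

lemma lr_minima_less_length: "i \<in> lr_minima u \<Longrightarrow> i < length u"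
  and non_lr_minima_less_length: "i \<in> non_lr_minima u \<Longrightarrow> i < length u"
  and finite_lr_minima [simp]: "finite (lr_minima u)"
  and finite_non_lr_minima [simp]: "finite (non_lr_minima u)"
  by (auto simp: lr_minima_def non_lr_minima_def)

lemma non_lr_minima_iff:
  assumes "distinct u"
  shows "i \<in> non_lr_minima u \<longleftrightarrow> i < length u \<and> (\<exists>j<i. u ! j < u ! i)"
proof -
  have "u ! i < u ! j \<longleftrightarrow> \<not> u ! j < u ! i" if "j < i" "i < length u" for j
    using assms that nth_eq_iff_index_eq [of u i j] by auto
  then show ?thesis by (auto simp: non_lr_minima_def lr_minima_def)
qed

text \<open>The minima below some non-minimum, i.e. those below the largest non-minimum; this form of
  the third invariant is meaningful even if there is no non-minimum.\<close>

definition low_minima :: "nat list \<Rightarrow> nat set" where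
  "low_minima u = {i \<in> lr_minima u. \<exists>k \<in> non_lr_minima u. u ! i < u ! k}"

lemma low_minima_eq:
  "non_lr_minima u \<noteq> {} \<Longrightarrow>
    low_minima u = {i \<in> lr_minima u. u ! i < Max ((!) u ` non_lr_minima u)}"
  by (auto simp: low_minima_def Max_gr_iff)

lemma class_set_iff:
  "\<pi> \<in> class_set m p v \<longleftrightarrow> is_perm \<pi> \<and> non_lr_minima \<pi> \<noteq> {} \<and>
     card (lr_minima \<pi>) = m \<and> Min (non_lr_minima \<pi>) = p \<and> card (low_minima \<pi>) = v"
  by (cases "non_lr_minima \<pi> = {}") (simp_all add: class_set_def low_minima_eq)

lemma order_iso_lr_minima:
  assumes "order_iso u w"
  shows "lr_minima u = lr_minima w" "non_lr_minima u = non_lr_minima w"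
    "low_minima u = low_minima w"
proof -
  have less: "u ! i < u ! j \<longleftrightarrow> w ! i < w ! j" if "i < length w" "j < length w" for i j
    using assms that by (auto simp: order_iso_def)
  have len: "length u = length w" using assms by (auto simp: order_iso_def)
  show lr: "lr_minima u = lr_minima w"
    using less len by (auto simp: lr_minima_def)
  then show nlr: "non_lr_minima u = non_lr_minima w"
    using len by (simp add: non_lr_minima_def)
  show "low_minima u = low_minima w"
    using less lr nlr lr_minima_less_length [of _ w] non_lr_minima_less_length [of _ w]
    by (auto simp: low_minima_def)
qed

text \<open>A move shifts positions but keeps the values of the minima, so the first and the third
  invariant are compared through values.\<close>

definition lr_values :: "nat list \<Rightarrow> nat set" where
  "lr_values u = (!) u ` lr_minima u"

lemma lr_values_append:
  "lr_values (u @ w) = lr_values u \<union> {t \<in> lr_values w. \<forall>s \<in> set u. t < s}"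
proof -
  have "t \<in> lr_values (u @ w) \<longleftrightarrow> t \<in> lr_values u \<or> (t \<in> lr_values w \<and> (\<forall>s \<in> set u. t < s))" for t
  proof
    assume "t \<in> lr_values (u @ w)"
    then obtain i where i: "i < length u + length w" "t = (u @ w) ! i"
      and min: "\<forall>j<i. (u @ w) ! i < (u @ w) ! j"
      by (auto simp: lr_values_def lr_minima_def)
    show "t \<in> lr_values u \<or> (t \<in> lr_values w \<and> (\<forall>s \<in> set u. t < s))"
    proof (cases "i < length u")
      case True
      then have "t = u ! i" "i \<in> lr_minima u"
        using i min by (auto simp: lr_minima_def nth_append)
      then show ?thesis by (auto simp: lr_values_def)
    next
      case False
      define k where "k = i - length u"
      have k: "i = length u + k" using False by (simp add: k_def)
      have "w ! k < w ! j" if "j < k" for j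
        using min [rule_format, of "length u + j"] that by (simp add: k nth_append)
      moreover have "w ! k < u ! j" if "j < length u" for j
        using min [rule_format, of j] that by (simp add: k nth_append)
      ultimately show ?thesis
        using i k by (auto simp: lr_values_def lr_minima_def in_set_conv_nth nth_append)
    qed
  next
    assume "t \<in> lr_values u \<or> (t \<in> lr_values w \<and> (\<forall>s \<in> set u. t < s))"
    then show "t \<in> lr_values (u @ w)"
    proof
      assume "t \<in> lr_values u"
      then obtain i where "i \<in> lr_minima u" "t = u ! i" by (auto simp: lr_values_def)
      then have "i \<in> lr_minima (u @ w)" "t = (u @ w) ! i"
        by (auto simp: lr_minima_def nth_append)
      then show ?thesis by (auto simp: lr_values_def)
    next
      assume *: "t \<in> lr_values w \<and> (\<forall>s \<in> set u. t < s)"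
      then obtain i where "i \<in> lr_minima w" "t = w ! i" by (auto simp: lr_values_def)
      then have "length u + i \<in> lr_minima (u @ w)" "t = (u @ w) ! (length u + i)"
        using * by (auto simp: lr_minima_def nth_append)
      then show ?thesis unfolding lr_values_def by blast
    qed
  qed
  then show ?thesis by blast
qed

lemma lr_values_Cons: "lr_values (t # w) = insert t {s \<in> lr_values w. s < t}"
proof -
  have "lr_values [t] = {t}" by (auto simp: lr_values_def lr_minima_def)
  then show ?thesis using lr_values_append [of "[t]" w] by auto
qed

lemma non_lr_values:
  assumes "distinct u"
  shows "(!) u ` non_lr_minima u = set u - lr_values u"
proof -
  have "inj_on ((!) u) {i. i < length u}"
    using assms by (auto simp: inj_on_def nth_eq_iff_index_eq)
  moreover have "lr_minima u \<subseteq> {i. i < length u}" by (auto simp: lr_minima_def)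
  moreover have "set u = (!) u ` {i. i < length u}" by (auto simp: set_conv_nth)
  ultimately show ?thesis
    by (simp add: non_lr_minima_def lr_values_def inj_on_image_set_diff)
qed

lemma inj_on_nth_lr_minima: "distinct u \<Longrightarrow> inj_on ((!) u) (lr_minima u)"
  by (auto simp: inj_on_def nth_eq_iff_index_eq lr_minima_less_length)

lemma card_lr_minima: "distinct u \<Longrightarrow> card (lr_minima u) = card (lr_values u)"
  by (simp add: lr_values_def card_image inj_on_nth_lr_minima)

lemma card_low_minima:
  assumes "distinct u"
  shows "card (low_minima u) = card {t \<in> lr_values u. \<exists>k \<in> set u - lr_values u. t < k}"
proof -
  have "(!) u ` low_minima u = {t \<in> lr_values u. \<exists>k \<in> set u - lr_values u. t < k}"
    unfolding low_minima_def non_lr_values [OF assms, symmetric] by (auto simp: lr_values_def)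
  moreover have "inj_on ((!) u) (low_minima u)"
    using inj_on_nth_lr_minima [OF assms] by (rule inj_on_subset) (auto simp: low_minima_def)
  ultimately show ?thesis by (metis card_image)
qed

lemma non_lr_minima_common_prefix:
  assumes "i < length L"
  shows "i \<in> non_lr_minima (L @ u) \<longleftrightarrow> i \<in> non_lr_minima L"
  using assms by (auto simp: non_lr_minima_def lr_minima_def nth_append)

text \<open>In both lists position \<open>length L\<close> holds a non-minimum, \<open>y\<close> or \<open>z\<close>, and the common
  prefix \<open>L\<close> decides which earlier positions do. In the third invariant \<open>z\<close> is a witness for
  every minimum for which \<open>y\<close> is one.\<close>

lemma move_invariants:
  assumes d: "distinct (L @ y # C @ z # D)" and x: "x \<in> set L" "x < y" "y < z"
  defines "u \<equiv> L @ y # C @ z # D" and "w \<equiv> L @ z # C @ D"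
  shows "card (lr_minima u) = card (lr_minima w)"
    "Min (non_lr_minima u) = Min (non_lr_minima w)"
    "card (low_minima u) = card (low_minima w)"
    "non_lr_minima u \<noteq> {}" "non_lr_minima w \<noteq> {}"
proof -
  have du: "distinct u" and dw: "distinct w" using d by (auto simp: u_def w_def)
  have lr: "lr_values u = lr_values w"
    using x by (force simp: u_def w_def lr_values_append lr_values_Cons)
  then show "card (lr_minima u) = card (lr_minima w)"
    by (simp add: card_lr_minima du dw)
  have "z \<notin> lr_values L" using d by (auto simp: lr_values_def lr_minima_less_length)
  then have "z \<notin> lr_values u"
    using x by (force simp: lr w_def lr_values_append)
  then have "(\<exists>k \<in> set u - lr_values u. t < k) \<longleftrightarrow> (\<exists>k \<in> set w - lr_values w. t < k)" for t
    using x unfolding lr by (auto simp: u_def w_def intro: less_trans)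
  then show "card (low_minima u) = card (low_minima w)"
    by (simp add: card_low_minima du dw lr)
  obtain j where "j < length L" "L ! j = x" using x by (metis in_set_conv_nth)
  then have at: "length L \<in> non_lr_minima u" "length L \<in> non_lr_minima w"
    unfolding non_lr_minima_iff [OF du] non_lr_minima_iff [OF dw]
    using x by (auto simp: u_def w_def nth_append intro!: exI [of _ j])
  then show ne: "non_lr_minima u \<noteq> {}" "non_lr_minima w \<noteq> {}" by auto
  have agree: "i \<in> non_lr_minima u \<longleftrightarrow> i \<in> non_lr_minima w" if "i \<le> length L" for i
    using that at by (cases "i = length L") (auto simp: u_def w_def non_lr_minima_common_prefix)
  have "Min (non_lr_minima u) \<le> length L" "Min (non_lr_minima w) \<le> length L"
    using at by simp_all
  then show "Min (non_lr_minima u) = Min (non_lr_minima w)"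
    using agree ne by (intro antisym Min_le) (metis Min_in finite_non_lr_minima)+
qed

text \<open>This relation is not reflexive: a decreasing permutation is not even related to itself.
  Together with \<open>step_invariants\<close> this says that such a permutation admits no step.\<close>

definition same_invariants :: "nat list \<Rightarrow> nat list \<Rightarrow> bool" where
  "same_invariants \<pi> \<sigma> \<longleftrightarrow> non_lr_minima \<pi> \<noteq> {} \<and> non_lr_minima \<sigma> \<noteq> {} \<and>
     card (lr_minima \<pi>) = card (lr_minima \<sigma>) \<and>
     Min (non_lr_minima \<pi>) = Min (non_lr_minima \<sigma>) \<and>
     card (low_minima \<pi>) = card (low_minima \<sigma>)"

lemma replacement_invariants:
  assumes "replacement pattern_123 pattern_13s \<pi> \<sigma>"
  shows "same_invariants \<pi> \<sigma>"
  using assms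
proof (rule replacementE)
  fix L x y C z D
  assume "distinct (L @ y # C @ z # D)" "x \<in> set L" "x < y" "y < z"
    and iso: "order_iso (L @ y # C @ z # D) \<pi>" "order_iso (L @ z # C @ D) \<sigma>"
  note inv = move_invariants [OF this(1-4)]
  show ?thesis
    using inv unfolding same_invariants_def
      order_iso_lr_minima [OF iso(1)] order_iso_lr_minima [OF iso(2)] by simp
qed

lemma step_invariants:
  assumes "step pattern_123 pattern_13s \<pi> \<sigma>"
  shows "same_invariants \<pi> \<sigma>"
  using assms replacement_invariants [of \<pi> \<sigma>]
    replacement_invariants [OF replacement_converse, of \<pi> \<sigma>]
  by (auto simp: step_def same_invariants_def)

lemma steps_invariants:
  assumes "(step pattern_123 pattern_13s)\<^sup>*\<^sup>* \<pi> \<sigma>"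
  shows "\<pi> = \<sigma> \<or> same_invariants \<pi> \<sigma>"
  using assms
proof (induction rule: rtranclp_induct)
  case (step \<sigma> \<tau>)
  then show ?case using step_invariants [of \<sigma> \<tau>] by (auto simp: same_invariants_def)
qed simp

section \<open>Reduction to a single non-left-to-right minimum\<close>

abbreviation steps :: "nat list \<Rightarrow> nat list \<Rightarrow> bool" where
  "steps \<equiv> (step pattern_123 pattern_13s)\<^sup>*\<^sup>*"

lemma steps_std:
  assumes "distinct (L @ y # C @ z # D)" "0 \<notin> set (L @ y # C @ z # D)" "x \<in> set L" "x < y" "y < z"
  shows "steps (std (L @ y # C @ z # D)) (std (L @ z # C @ D))"
  using replacement_std [OF assms] by (auto simp: step_def)

text \<open>A later and smaller non-minimum \<open>t\<close> is deleted by the detour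
  \<open>L z C t D \<leftarrow> L y C t z D \<rightarrow> L y C z D \<rightarrow> L z C D\<close>
  with an auxiliary entry \<open>y\<close> between \<open>x\<close> and \<open>z\<close>. The three moves use the smaller entries
  \<open>x\<close>, \<open>s\<close> and \<open>x\<close>.\<close>

lemma delete_smaller_later:
  assumes d: "distinct (L @ z # C @ t # D)" and pos: "0 \<notin> set (L @ z # C @ t # D)"
    and x: "x \<in> set L" "x < z" and s: "s \<in> set (L @ C)" "s < t" and tz: "t < z"
  shows "steps (std (L @ z # C @ t # D)) (std (L @ z # C @ D))"
proof -
  \<comment> \<open>Doubling all entries makes room for \<open>y = 2 * x + 1\<close>, which is odd and therefore new.\<close>
  let ?f = "\<lambda>n::nat. 2 * n"
  have iso: "std (map ?f u) = std u" for u
    by (intro std_eq_if_order_iso) (simp add: order_iso_def)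
  define L' C' D' where "L' = map ?f L" and "C' = map ?f C" and "D' = map ?f D"
  define x' s' t' z' y where "x' = 2 * x" and "s' = 2 * s" and "t' = 2 * t" and "z' = 2 * z"
    and "y = Suc (2 * x)"
  note defs = L'_def C'_def D'_def x'_def s'_def t'_def z'_def y_def
  have y_new: "y \<notin> set (map ?f u)" for u
    unfolding y_def by (auto, presburger)
  have d': "distinct (L' @ y # C' @ t' # z' # D')"
    using d y_new [of L] y_new [of C] y_new [of "[t, z]"] y_new [of D]
    by (auto simp: L'_def C'_def D'_def t'_def z'_def distinct_map inj_on_def)
  have pos': "0 \<notin> set (L' @ y # C' @ t' # z' # D')"
    using pos by (auto simp: defs)
  have ord: "x' < y" "y < z'" "s' < t'" "t' < z'" "x' \<in> set L'" "s' \<in> set (L' @ y # C')"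
    using x s tz by (auto simp: defs)
  have 0: "steps (std (L' @ y # (C' @ [t']) @ z' # D')) (std (L' @ z' # (C' @ [t']) @ D'))"
    using d' pos' ord by (intro steps_std [where x = x']) auto
  have 1: "steps (std (L' @ z' # C' @ t' # D')) (std (L' @ y # C' @ t' # z' # D'))"
    using steps_sym [OF 0] by simp
  have "steps (std ((L' @ y # C') @ t' # [] @ z' # D')) (std ((L' @ y # C') @ z' # [] @ D'))"
    using d' pos' ord by (intro steps_std [where x = s']) auto
  then have 2: "steps (std (L' @ y # C' @ t' # z' # D')) (std (L' @ y # C' @ z' # D'))"
    by simp
  have 3: "steps (std (L' @ y # C' @ z' # D')) (std (L' @ z' # C' @ D'))"
    using d' pos' ord by (intro steps_std [where x = x']) auto
  have "L' @ z' # C' @ t' # D' = map ?f (L @ z # C @ t # D)"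
    "L' @ z' # C' @ D' = map ?f (L @ z # C @ D)"
    by (auto simp: defs)
  with 1 2 3 show ?thesis
    by (metis iso rtranclp_trans)
qed

text \<open>Whichever of two non-minima is the smaller can be deleted.\<close>

lemma steps_to_shorter:
  assumes perm: "is_perm \<pi>" and ik: "i \<in> non_lr_minima \<pi>" "k \<in> non_lr_minima \<pi>" "i < k"
  obtains \<sigma> where "is_perm \<sigma>" "length \<sigma> < length \<pi>" "steps \<pi> \<sigma>"
proof -
  have d: "distinct \<pi>" and pos: "0 \<notin> set \<pi>" using perm by (auto simp: is_perm_def)
  obtain a where a: "a < i" "\<pi> ! a < \<pi> ! i" using ik non_lr_minima_iff [OF d] by blast
  obtain b where b: "b < k" "\<pi> ! b < \<pi> ! k" using ik non_lr_minima_iff [OF d] by blast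
  have k: "k < length \<pi>" using ik non_lr_minima_less_length by blast
  define L C D where "L = take i \<pi>" and "C = take (k - Suc i) (drop (Suc i) \<pi>)"
    and "D = drop (Suc k) \<pi>"
  have "drop (Suc i) \<pi> = C @ \<pi> ! k # D"
    using id_take_nth_drop [of "k - Suc i" "drop (Suc i) \<pi>"] ik k
    by (simp add: C_def D_def)
  then have \<pi>: "\<pi> = L @ \<pi> ! i # C @ \<pi> ! k # D"
    using id_take_nth_drop [of i \<pi>] ik k by (simp add: L_def)
  have aL: "\<pi> ! a \<in> set L"
    using a ik k by (auto simp: L_def in_set_conv_nth)
  have tk: "take k \<pi> = L @ \<pi> ! i # C"
  proof -
    have "k = length (L @ \<pi> ! i # C)" using ik k by (simp add: L_def C_def)
    moreover have "\<pi> = (L @ \<pi> ! i # C) @ \<pi> ! k # D" using \<pi> by simp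
    ultimately show ?thesis by (metis append_eq_conv_conj)
  qed
  have "\<pi> ! b \<in> set (take k \<pi>)" using b k by (auto simp: in_set_conv_nth)
  then have bm: "\<pi> ! b \<in> set (L @ \<pi> ! i # C)" by (simp add: tk)
  define z t where "z = \<pi> ! i" and "t = \<pi> ! k"
  have eq: "\<pi> = L @ z # C @ t # D" using \<pi> by (simp add: z_def t_def)
  have d': "distinct (L @ z # C @ t # D)" and pos': "0 \<notin> set (L @ z # C @ t # D)"
    using d pos eq by simp_all
  have x: "\<pi> ! a \<in> set L" "\<pi> ! a < z" using aL a by (simp_all add: z_def)
  have std: "std (L @ z # C @ t # D) = \<pi>" using std_perm [OF perm] eq by simp
  have "z \<noteq> t" using d' by auto
  then consider "z < t" | "t < z" by linarith
  then show thesis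
  proof cases
    case 1
    have "steps \<pi> (std (L @ t # C @ D))"
      using steps_std [OF d' pos' x 1] by (simp only: std)
    moreover have "length (std (L @ t # C @ D)) < length \<pi>"
      using arg_cong [OF eq, of length] by simp
    moreover have "distinct (L @ t # C @ D)" using d' by auto
    ultimately show ?thesis using that is_perm_std by blast
  next
    case 2
    have "\<pi> ! b \<in> set (L @ C)" using bm b 2 by (auto simp: z_def t_def)
    moreover have "\<pi> ! b < t" using b by (simp add: t_def)
    ultimately have "steps \<pi> (std (L @ z # C @ D))"
      using delete_smaller_later [OF d' pos' x _ _ 2] unfolding std by blast
    moreover have "length (std (L @ z # C @ D)) < length \<pi>"
      using arg_cong [OF eq, of length] by simp
    moreover have "distinct (L @ z # C @ D)" using d' by auto
    ultimately show ?thesis using that is_perm_std by blast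
  qed
qed

lemma steps_to_single:
  assumes "is_perm \<pi>" "non_lr_minima \<pi> \<noteq> {}"
  shows "\<exists>\<sigma>. is_perm \<sigma> \<and> steps \<pi> \<sigma> \<and> (\<exists>p. non_lr_minima \<sigma> = {p})"
  using assms
proof (induction \<pi> rule: length_induct)
  case (1 \<pi>)
  obtain i where i: "i \<in> non_lr_minima \<pi>" using "1.prems" by auto
  show ?case
  proof (cases "non_lr_minima \<pi> = {i}")
    case True
    then show ?thesis using "1.prems" by blast
  next
    case False
    then obtain j where "j \<in> non_lr_minima \<pi>" "j \<noteq> i" using i by auto
    then obtain \<sigma> where \<sigma>: "is_perm \<sigma>" "length \<sigma> < length \<pi>" "steps \<pi> \<sigma>"
      using steps_to_shorter [OF "1.prems"(1)] i by (metis nat_neq_iff)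
    then have "non_lr_minima \<sigma> \<noteq> {}"
      using steps_invariants [OF \<sigma>(3)] "1.prems" by (auto simp: same_invariants_def)
    then obtain \<tau> where "is_perm \<tau>" "steps \<sigma> \<tau>" "\<exists>p. non_lr_minima \<tau> = {p}"
      using 1 \<sigma> by blast
    then show ?thesis using \<sigma> by (meson rtranclp_trans)
  qed
qed

text \<open>If there is only one non-minimum, all other entries are minima, so its value is determined
  by the number of minima below it.\<close>

lemma single_parameters:
  assumes perm: "is_perm \<pi>" and single: "non_lr_minima \<pi> = {p}"
  shows "length \<pi> = Suc (card (lr_minima \<pi>))" "\<pi> ! p = Suc (card (low_minima \<pi>))"
proof -
  have d: "distinct \<pi>" and s: "set \<pi> = {1..length \<pi>}"
    using perm by (auto simp: is_perm_def)
  have p: "p < length \<pi>" using single non_lr_minima_less_length by blast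
  have lr: "lr_minima \<pi> = {..<length \<pi>} - {p}"
    using single lr_minima_less_length [of _ \<pi>] by (auto simp: non_lr_minima_def)
  then show "length \<pi> = Suc (card (lr_minima \<pi>))" using p by simp
  have low: "low_minima \<pi> = {i. i < length \<pi> \<and> \<pi> ! i < \<pi> ! p}"
    by (auto simp: low_minima_def single lr)
  have "(!) \<pi> ` low_minima \<pi> = {t \<in> set \<pi>. t < \<pi> ! p}"
    unfolding low by (auto simp: set_conv_nth)
  also have "\<dots> = {1..<\<pi> ! p}" using nth_mem [OF p] unfolding s by auto
  finally have "card ((!) \<pi> ` low_minima \<pi>) = \<pi> ! p - 1" by simp
  moreover have "inj_on ((!) \<pi>) (low_minima \<pi>)"
    unfolding low using d by (auto simp: inj_on_def nth_eq_iff_index_eq)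
  moreover have "1 \<le> \<pi> ! p" using nth_mem [OF p] unfolding s by simp
  ultimately show "\<pi> ! p = Suc (card (low_minima \<pi>))" by (simp add: card_image)
qed

lemma decreasing_unique:
  fixes u w :: "nat list"
  assumes "sorted_wrt (>) u" "sorted_wrt (>) w" "set u = set w"
  shows "u = w"
proof -
  have "sorted_wrt (<) (rev u)" "sorted_wrt (<) (rev w)"
    using assms by (simp_all add: sorted_wrt_rev)
  then have "rev u = rev w"
    using assms(3) by (intro strict_sorted_equal) auto
  then show ?thesis by simp
qed

text \<open>Without the entry at index \<open>p\<close> the list is decreasing, and its entries are all numbers up
  to the length except the one at \<open>p\<close>, which \<open>single_parameters\<close> determines.\<close>

lemma single_unique:
  assumes \<pi>: "is_perm \<pi>" "non_lr_minima \<pi> = {p}" and \<sigma>: "is_perm \<sigma>" "non_lr_minima \<sigma> = {p}"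
    and m: "card (lr_minima \<pi>) = card (lr_minima \<sigma>)"
    and v: "card (low_minima \<pi>) = card (low_minima \<sigma>)"
  shows "\<pi> = \<sigma>"
proof -
  have len: "length \<pi> = length \<sigma>" and val: "\<pi> ! p = \<sigma> ! p"
    using single_parameters [OF \<pi>] single_parameters [OF \<sigma>] m v by simp_all
  have split: "\<tau> = take p \<tau> @ \<tau> ! p # drop (Suc p) \<tau>"
      "sorted_wrt (>) (take p \<tau> @ drop (Suc p) \<tau>)"
      "set (take p \<tau> @ drop (Suc p) \<tau>) = {1..length \<tau>} - {\<tau> ! p}" "p < length \<tau>"
    if "is_perm \<tau>" "non_lr_minima \<tau> = {p}" for \<tau>
  proof -
    show p: "p < length \<tau>" using that non_lr_minima_less_length by blast
    then show eq: "\<tau> = take p \<tau> @ \<tau> ! p # drop (Suc p) \<tau>" by (rule id_take_nth_drop)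
    have "distinct (take p \<tau> @ \<tau> ! p # drop (Suc p) \<tau>)"
      using that eq by (metis is_perm_def)
    moreover have "set (take p \<tau> @ \<tau> ! p # drop (Suc p) \<tau>) = {1..length \<tau>}"
      using that eq by (metis is_perm_def)
    ultimately show "set (take p \<tau> @ drop (Suc p) \<tau>) = {1..length \<tau>} - {\<tau> ! p}"
      by auto
    have less: "\<tau> ! j < \<tau> ! i" if "i < j" "j < length \<tau>" "j \<noteq> p" for i j
      using \<open>non_lr_minima \<tau> = {p}\<close> that by (auto simp: non_lr_minima_def lr_minima_def)
    then show "sorted_wrt (>) (take p \<tau> @ drop (Suc p) \<tau>)"
      using p by (auto simp: sorted_wrt_iff_nth_less nth_append min_def)
  qed
  have eq: "take p \<pi> @ drop (Suc p) \<pi> = take p \<sigma> @ drop (Suc p) \<sigma>"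
    using split(2,3) [OF \<pi>] split(2,3) [OF \<sigma>] len val by (intro decreasing_unique) auto
  then have "take p \<pi> = take p \<sigma>" "drop (Suc p) \<pi> = drop (Suc p) \<sigma>"
    using split(4) [OF \<pi>] split(4) [OF \<sigma>] by (auto simp: append_eq_append_conv)
  then show ?thesis using split(1) [OF \<pi>] split(1) [OF \<sigma>] val by metis
qed

text \<open>Both permutations reduce to one with a single non-minimum. Reduction keeps the invariants,
  so the two results coincide if the invariants agree.\<close>

lemma steps_iff_same_invariants:
  assumes \<pi>: "is_perm \<pi>" "non_lr_minima \<pi> \<noteq> {}" and \<sigma>: "is_perm \<sigma>"
  shows "steps \<pi> \<sigma> \<longleftrightarrow> same_invariants \<pi> \<sigma>"
proof
  assume "steps \<pi> \<sigma>"
  then show "same_invariants \<pi> \<sigma>"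
    using steps_invariants [of \<pi> \<sigma>] \<pi> by (auto simp: same_invariants_def)
next
  assume same: "same_invariants \<pi> \<sigma>"
  obtain \<pi>' p where \<pi>': "is_perm \<pi>'" "steps \<pi> \<pi>'" "non_lr_minima \<pi>' = {p}"
    using steps_to_single [OF \<pi>] by blast
  obtain \<sigma>' q where \<sigma>': "is_perm \<sigma>'" "steps \<sigma> \<sigma>'" "non_lr_minima \<sigma>' = {q}"
    using steps_to_single [OF \<sigma>] same by (auto simp: same_invariants_def)
  have "same_invariants \<pi>' \<sigma>'"
    using same steps_invariants [OF \<pi>'(2)] steps_invariants [OF \<sigma>'(2)]
    by (auto simp: same_invariants_def)
  then have "\<pi>' = \<sigma>'"
    using \<pi>' \<sigma>' by (intro single_unique [of _ p]) (auto simp: same_invariants_def)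
  then show "steps \<pi> \<sigma>"
    using \<pi>'(2) steps_sym [OF \<sigma>'(2)] by simp
qed

section \<open>The possible values of the invariants\<close>

lemma reverse_identity_perm: "is_perm (reverse_identity n)"
  by (auto simp: is_perm_def reverse_identity_def)

lemma length_reverse_identity: "length (reverse_identity n) = n"
  by (simp add: reverse_identity_def del: upt_Suc)

lemma reverse_identity_decreasing: "sorted_wrt (>) (reverse_identity n)"
  unfolding reverse_identity_def sorted_wrt_rev by (simp del: upt_Suc)

lemma non_lr_minima_empty_iff:
  assumes "is_perm \<pi>"
  shows "non_lr_minima \<pi> = {} \<longleftrightarrow> \<pi> = reverse_identity (length \<pi>)"
proof
  assume "non_lr_minima \<pi> = {}"
  then have "\<pi> ! j < \<pi> ! i" if "i < j" "j < length \<pi>" for i j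
    using that unfolding non_lr_minima_def lr_minima_def by blast
  then have "sorted_wrt (>) \<pi>"
    by (simp add: sorted_wrt_iff_nth_less)
  then show "\<pi> = reverse_identity (length \<pi>)"
  proof (rule decreasing_unique [OF _ reverse_identity_decreasing])
    show "set \<pi> = set (reverse_identity (length \<pi>))"
      using assms reverse_identity_perm [of "length \<pi>"]
      unfolding is_perm_def length_reverse_identity by (simp only:)
  qed
next
  assume *: "\<pi> = reverse_identity (length \<pi>)"
  have "sorted_wrt (>) \<pi>"
    by (subst *) (rule reverse_identity_decreasing)
  then have "\<pi> ! j < \<pi> ! i" if "i < j" "j < length \<pi>" for i j
    using sorted_wrt_nth_less [of "(>)" \<pi> i j] that by simp
  then have "i \<in> lr_minima \<pi>" if "i < length \<pi>" for i
    using that by (simp add: lr_minima_def)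
  then show "non_lr_minima \<pi> = {}" unfolding non_lr_minima_def by blast
qed

text \<open>The bound \<open>m < p + v\<close> comes from index \<open>p - 1\<close>, which holds the smallest entry before the
  first non-minimum and hence one smaller than it. All minima from there on are low, and only the
  \<open>p - 1\<close> minima before it may fail to be.\<close>

lemma parameter_bounds:
  assumes "\<pi> \<in> class_set m p v"
  shows "1 \<le> p" "p \<le> m" "1 \<le> v" "v \<le> m" "m < p + v"
proof -
  from assms have perm: "is_perm \<pi>" and ne: "non_lr_minima \<pi> \<noteq> {}"
    and m: "card (lr_minima \<pi>) = m" and p: "Min (non_lr_minima \<pi>) = p"
    and v: "card (low_minima \<pi>) = v"
    by (auto simp: class_set_iff)
  have d: "distinct \<pi>" using perm by (simp add: is_perm_def)
  have pn: "p \<in> non_lr_minima \<pi>" using ne p Min_in by force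
  then obtain j where j: "j < p" "\<pi> ! j < \<pi> ! p" and pl: "p < length \<pi>"
    using non_lr_minima_iff [OF d] by blast
  then show p1: "1 \<le> p" by simp
  have before: "i \<in> lr_minima \<pi>" if "i < p" for i
    using that pl p Min_le [OF finite_non_lr_minima, of i \<pi>] by (auto simp: non_lr_minima_def)
  then have "card {..<p} \<le> card (lr_minima \<pi>)" by (intro card_mono) auto
  then show pm: "p \<le> m" using m by simp
  have "low_minima \<pi> \<subseteq> lr_minima \<pi>" by (auto simp: low_minima_def)
  then show "v \<le> m" using m v card_mono finite_lr_minima by metis
  have "j = p - 1 \<or> j < p - 1" using j by linarith
  then have "\<pi> ! (p - 1) \<le> \<pi> ! j"
    using before [of "p - 1"] p1 by (auto simp: lr_minima_def less_imp_le)
  then have last: "\<pi> ! (p - 1) < \<pi> ! p" using j by simp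
  have "lr_minima \<pi> - {..<p - 1} \<subseteq> low_minima \<pi>"
  proof
    fix i assume i: "i \<in> lr_minima \<pi> - {..<p - 1}"
    then have "i = p - 1 \<or> p - 1 < i" by auto
    then have "\<pi> ! i \<le> \<pi> ! (p - 1)"
      using i by (auto simp: lr_minima_def less_imp_le)
    with last have "\<pi> ! i < \<pi> ! p" by simp
    then show "i \<in> low_minima \<pi>" using i pn unfolding low_minima_def by blast
  qed
  then have "card (lr_minima \<pi> - {..<p - 1}) \<le> card (low_minima \<pi>)"
    by (rule card_mono [rotated]) (simp add: low_minima_def)
  moreover have "card (lr_minima \<pi>) - card {..<p - 1} \<le> card (lr_minima \<pi> - {..<p - 1})"
    by (intro diff_card_le_card_Diff) simp
  ultimately show "m < p + v" using m v p1 by simp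
  then show "1 \<le> v" using pm by simp
qed

text \<open>The witness is the permutation with a single non-minimum: here \<open>r\<close> enumerates
  \<open>{1..m + 1} - {v + 1}\<close> in decreasing order, and \<open>f\<close> inserts \<open>v + 1\<close> at index \<open>p\<close>. The
  inequality \<open>m < p + v\<close> says that the entry before it is smaller.\<close>

lemma class_set_nonempty:
  assumes "1 \<le> p" "p \<le> m" "v \<le> m" "m < p + v"
  shows "class_set m p v \<noteq> {}"
proof -
  define r where "r i = (if v < m - i then Suc (m - i) else m - i)" for i
  define f where "f i = (if i < p then r i else if i = p then Suc v else r (i - 1))" for i
  define \<pi> where "\<pi> = map f [0..<Suc m]"
  have len: "length \<pi> = Suc m" by (simp add: \<pi>_def)
  have nth: "\<pi> ! i = f i" if "i < Suc m" for i
    using that unfolding \<pi>_def by (simp del: upt_Suc)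
  have down: "f j < f i" if "i < j" "j < Suc m" "j \<noteq> p" for i j
    using that assms by (auto simp: f_def r_def)
  have up: "f (p - 1) < f p" using assms by (auto simp: f_def r_def)
  have neq: "f i \<noteq> f j" if "i < j" "j < Suc m" for i j
    using that assms by (auto simp: f_def r_def split: if_splits)
  have "inj_on f {0..<Suc m}"
    unfolding inj_on_def by (metis neq nat_neq_iff atLeastLessThan_iff)
  then have d: "distinct \<pi>" by (simp add: \<pi>_def distinct_map del: upt_Suc)
  have "set \<pi> \<subseteq> {1..Suc m}"
    using assms by (auto simp: \<pi>_def f_def r_def simp del: upt_Suc)
  then have "set \<pi> = {1..Suc m}"
    using distinct_card [OF d] len by (intro card_subset_eq) auto
  then have perm: "is_perm \<pi>" using d len by (simp add: is_perm_def)
  have "i \<in> lr_minima \<pi>" if "i < Suc m" "i \<noteq> p" for i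
    using that down by (simp add: lr_minima_def len nth)
  moreover have "p \<notin> lr_minima \<pi>"
  proof
    assume "p \<in> lr_minima \<pi>"
    then have "\<pi> ! p < \<pi> ! (p - 1)" using assms by (simp add: lr_minima_def)
    then show False using up assms by (simp add: nth)
  qed
  ultimately have "lr_minima \<pi> = {..<Suc m} - {p}"
    using lr_minima_less_length [of _ \<pi>] len by auto
  moreover have "p < Suc m" using assms(2) by simp
  ultimately have single: "non_lr_minima \<pi> = {p}"
    unfolding non_lr_minima_def len by blast
  have "\<pi> ! p = Suc v"
    using nth [of p] \<open>p < Suc m\<close> by (simp add: f_def)
  then have "card (lr_minima \<pi>) = m" "card (low_minima \<pi>) = v"
    using single_parameters [OF perm single] len by simp_all
  then have "\<pi> \<in> class_set m p v" using perm single by (simp add: class_set_iff)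
  then show ?thesis by blast
qed

section \<open>The equivalence classes\<close>

abbreviation class_of :: "nat list \<Rightarrow> nat list set" where
  "class_of \<pi> \<equiv> equivalence pattern_123 pattern_13s `` {\<pi>}"

lemma class_of_reverse_identity: "class_of (reverse_identity n) = {reverse_identity n}"
proof -
  have "non_lr_minima (reverse_identity n) = {}"
    using non_lr_minima_empty_iff [OF reverse_identity_perm, of n]
    by (simp add: length_reverse_identity)
  then have "steps (reverse_identity n) \<sigma> \<longleftrightarrow> \<sigma> = reverse_identity n" for \<sigma>
    using steps_invariants [of "reverse_identity n" \<sigma>] by (auto simp: same_invariants_def)
  then show ?thesis
    using reverse_identity_perm by (auto simp: equivalence_iff)
qed

lemma class_of_class_set:
  assumes "\<pi> \<in> class_set m p v"
  shows "class_of \<pi> = class_set m p v"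
  using assms steps_iff_same_invariants [of \<pi>]
  by (auto simp: class_set_iff equivalence_iff same_invariants_def)

theorem theorem24:
  defines "classes \<equiv> equiv_classes pattern_123 pattern_13s"
  defines "triples \<equiv> {(m, p, v). 1 \<le> p \<and> p \<le> m \<and> 1 \<le> v \<and> v \<le> m \<and> m < p + v}"
  shows "(\<forall>m p v. 1 \<le> p \<and> p \<le> m \<and> 1 \<le> v \<and> v \<le> m \<longrightarrow>
            (if m < p + v then class_set m p v \<in> classes else class_set m p v = {})) \<and>
         inj_on (\<lambda>(m, p, v). class_set m p v) triples \<and>
         (\<forall>n. {reverse_identity n} \<in> classes) \<and>
         classes = (\<lambda>(m, p, v). class_set m p v) ` triples \<union> range (\<lambda>n. {reverse_identity n})"
proof -
  have classes: "classes = class_of ` {\<pi>. is_perm \<pi>}"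
    by (auto simp: classes_def equiv_classes_def quotient_def)
  have inhabited: "\<exists>\<pi>. \<pi> \<in> class_set m p v" if "(m, p, v) \<in> triples" for m p v
    using class_set_nonempty [of p m v] that by (simp add: triples_def ex_in_conv)
  have set_class: "class_set m p v \<in> classes" if mpv: "(m, p, v) \<in> triples" for m p v
  proof -
    obtain \<pi> where "\<pi> \<in> class_set m p v"
      using inhabited [OF mpv] by blast
    then show ?thesis
      using class_of_class_set [of \<pi>] unfolding classes by (auto simp: class_set_iff)
  qed
  have rev_class: "{reverse_identity n} \<in> classes" for n
    using class_of_reverse_identity [of n] reverse_identity_perm [of n] unfolding classes by blast
  have "(m, p, v) = (m', p', v')"
    if mpv: "(m, p, v) \<in> triples" and eq: "class_set m p v = class_set m' p' v'" for m p v m' p' v'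
  proof -
    obtain \<pi> where "\<pi> \<in> class_set m p v" using inhabited [OF mpv] by blast
    moreover from this have "\<pi> \<in> class_set m' p' v'" by (simp only: eq)
    ultimately show ?thesis unfolding class_set_iff by blast
  qed
  then have inj: "inj_on (\<lambda>(m, p, v). class_set m p v) triples"
    unfolding inj_on_def by force
  have "class_of \<pi> \<in> (\<lambda>(m, p, v). class_set m p v) ` triples \<union> range (\<lambda>n. {reverse_identity n})"
    if perm: "is_perm \<pi>" for \<pi>
  proof (cases "non_lr_minima \<pi> = {}")
    case True
    then have "\<pi> = reverse_identity (length \<pi>)" using non_lr_minima_empty_iff [OF perm] by blast
    then have "class_of \<pi> = {reverse_identity (length \<pi>)}"
      using class_of_reverse_identity by metis
    then show ?thesis by blast
  next
    case False
    define m p v where "m = card (lr_minima \<pi>)" and "p = Min (non_lr_minima \<pi>)"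
      and "v = card (low_minima \<pi>)"
    have mpv: "\<pi> \<in> class_set m p v"
      using perm False by (simp add: class_set_iff m_def p_def v_def)
    have "(m, p, v) \<in> triples"
      using parameter_bounds [OF mpv] by (simp add: triples_def)
    then have "class_set m p v \<in> (\<lambda>(m, p, v). class_set m p v) ` triples"
      by (rule rev_image_eqI) simp
    then show ?thesis unfolding class_of_class_set [OF mpv] by blast
  qed
  then have "classes \<subseteq> (\<lambda>(m, p, v). class_set m p v) ` triples \<union> range (\<lambda>n. {reverse_identity n})"
    unfolding classes by blast
  moreover have "(\<lambda>(m, p, v). class_set m p v) ` triples \<subseteq> classes"
    using set_class by (simp add: image_subset_iff split_paired_all)
  moreover have "range (\<lambda>n. {reverse_identity n}) \<subseteq> classes"
    using rev_class by blast
  ultimately have all: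
    "classes = (\<lambda>(m, p, v). class_set m p v) ` triples \<union> range (\<lambda>n. {reverse_identity n})"
    by (intro subset_antisym Un_least)
  have empty: "class_set m p v = {}" if "\<not> m < p + v" for m p v
  proof (rule equals0I)
    fix \<pi> assume "\<pi> \<in> class_set m p v"
    then show False using parameter_bounds(5) [of \<pi> m p v] that by simp
  qed
  show ?thesis
  proof (intro conjI allI impI)
    fix m p v :: nat
    assume "1 \<le> p \<and> p \<le> m \<and> 1 \<le> v \<and> v \<le> m"
    then show "if m < p + v then class_set m p v \<in> classes else class_set m p v = {}"
      using set_class [of m p v] empty [of m p v] by (simp add: triples_def)
  qed (fact inj rev_class all)+
qed

end
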